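(* For every $k\ge 2$ there exist $d=d(k)$, $t=t(k)$ and a constant $c_2=c_2(k)>0$ such that for all $n$, $$R^{d,t}_{k}(n)\geq \mathrm{twr}_{k-1}(c_2 n).$$
   Context: The tower function is defined by $\mathrm{twr}_1(x)=x$ and $\mathrm{twr}_{i+1}(x)=2^{\mathrm{twr}_i(x)}$. Let $P=\{p_1,\dots,p_N\}$ be an ordered set of points in $\mathbb{R}^d$ and let $\binom{P}{k}$ denote the set of $k$-tuples $(p_{i_1},\dots,p_{i_k})$ with $i_1<\dots<i_k$. A relation $E\subset\binom{P}{k}$ is semi-algebraic of complexity at most $t$ if there are polynomials $f_1,\dots,f_t\in\mathbb{R}[x_1,\dots,x_{dk}]$ of degree at most $t$ and a Boolean function $\Phi$ such that, with $E^*=\{x\in\mathbb{R}^{dk}:\Phi(f_1(x)\ge 0,\dots,f_t(x)\ge 0)=1\}$, we have $(p_{i_1},\dots,p_{i_k})\in E$ iff $(p_{i_1},\dots,p_{i_k})\in E^*$ for all $i_1<\dots<i_k$. A subset $S\subset P$ is homogeneous if $\binom{S}{k}\subset E$ or $\binom{S}{k}\cap E=\emptyset$; $\mathrm{hom}(P,E)$ is the largest size of a homogeneous subset. $R^{d,t}_k(n)$ is the minimum $N$ such that every ordered $N$-element point set $P\subset\mathbb{R}^d$ with every $k$-ary semi-algebraic relation $E\subset\binom{P}{k}$ of complexity at most $t$ satisfies $\mathrm{hom}(P,E)\ge n$.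
   Formalization: "For all n" is replaced by "for all n ≥ n_0(k)": the literal claim fails for small n, e.g. k = 3, n = 1, where R = 1 < 2^{c_2} = twr_2(c_2) for every c_2 > 0. *)

theory Defs
  imports Complex_Main "HOL-Library.Poly_Mapping" "HOL-Library.Sublist"
begin

text \<open>The indexing starts at 1; the value at index 0 is a dummy.\<close>

fun twr :: "nat \<Rightarrow> real \<Rightarrow> real" where
  "twr 0 x = x"
| "twr (Suc 0) x = x"
| "twr (Suc (Suc i)) x = 2 powr (twr (Suc i) x)"

text \<open>A real polynomial in the variables \<open>x\<^sub>0, x\<^sub>1, \<dots>\<close> maps each monomial (a finitely supported
  exponent vector) to its coefficient.\<close>

type_synonym mpoly = "(nat \<Rightarrow>\<^sub>0 nat) \<Rightarrow>\<^sub>0 real"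

definition mpoly_vars :: "mpoly \<Rightarrow> nat set" where
  "mpoly_vars f = (\<Union>m\<in>Poly_Mapping.keys f. Poly_Mapping.keys m)"

definition total_degree :: "mpoly \<Rightarrow> nat" where
  "total_degree f = Max (insert 0
     ((\<lambda>m. \<Sum>i\<in>Poly_Mapping.keys m. Poly_Mapping.lookup m i) ` Poly_Mapping.keys f))"

definition mpoly_eval :: "mpoly \<Rightarrow> real list \<Rightarrow> real" where
  "mpoly_eval f x = (\<Sum>m\<in>Poly_Mapping.keys f. Poly_Mapping.lookup f m *
     (\<Prod>i\<in>Poly_Mapping.keys m. (x ! i) ^ Poly_Mapping.lookup m i))"

text \<open>A point of \<open>\<real>\<^sup>d\<close> is a list of \<open>d\<close> reals, so that the concatenation of a \<open>k\<close>-tuple of points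
  is a point of \<open>\<real>\<^sup>d\<^sup>k\<close>.  An ordered point set is a list without repetitions.\<close>

definition ordered_point_set :: "nat \<Rightarrow> real list list \<Rightarrow> bool" where
  "ordered_point_set d P \<longleftrightarrow> distinct P \<and> (\<forall>p\<in>set P. length p = d)"

text \<open>For a repetition-free list \<open>P\<close>, the subsequences of length \<open>k\<close> are exactly the tuples
  \<open>(p\<^sub>i, \<dots>)\<close> with strictly increasing indices.\<close>

definition tuples :: "nat \<Rightarrow> 'a list \<Rightarrow> 'a list set" where
  "tuples k P = {T. subseq T P \<and> length T = k}"

definition semialgebraic_set ::
    "nat \<Rightarrow> mpoly list \<Rightarrow> (bool list \<Rightarrow> bool) \<Rightarrow> real list set" where
  "semialgebraic_set m fs \<Phi> = {x. length x = m \<and> \<Phi> (map (\<lambda>f. mpoly_eval f x \<ge> 0) fs)}"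

definition semialgebraic_relation ::
    "nat \<Rightarrow> nat \<Rightarrow> nat \<Rightarrow> real list list \<Rightarrow> real list list set \<Rightarrow> bool" where
  "semialgebraic_relation d t k P E \<longleftrightarrow>
     E \<subseteq> tuples k P \<and>
     (\<exists>fs \<Phi>. length fs = t \<and>
        (\<forall>f\<in>set fs. mpoly_vars f \<subseteq> {..<d * k} \<and> total_degree f \<le> t) \<and>
        (\<forall>T\<in>tuples k P. T \<in> E \<longleftrightarrow> concat T \<in> semialgebraic_set (d * k) fs \<Phi>))"

definition homogeneous :: "nat \<Rightarrow> 'a list set \<Rightarrow> 'a list \<Rightarrow> bool" where
  "homogeneous k E S \<longleftrightarrow> tuples k S \<subseteq> E \<or> tuples k S \<inter> E = {}"

text \<open>A subset of \<open>P\<close>, with the inherited order, is a subsequence of \<open>P\<close>, and its size is its length.\<close>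

definition hom_size :: "nat \<Rightarrow> 'a list \<Rightarrow> 'a list set \<Rightarrow> nat" where
  "hom_size k P E = Max {length S |S. subseq S P \<and> homogeneous k E S}"

text \<open>By Ramsey's theorem such an \<open>N\<close> always exists, so \<open>LEAST\<close> is a genuine minimum.\<close>

definition semialg_ramsey :: "nat \<Rightarrow> nat \<Rightarrow> nat \<Rightarrow> nat \<Rightarrow> nat" where
  "semialg_ramsey d t k n = (LEAST N. \<forall>P E.
     ordered_point_set d P \<and> length P = N \<and> semialgebraic_relation d t k P E
       \<longrightarrow> hom_size k P E \<ge> n)"

end

theory Submission
  imports Defs "HOL-Library.Ramsey"
begin

text \<open>The colouring comes from the stepping-up lemma of Erdos and Hajnal: a \<open>(k+1)\<close>-tuple of
  integers below \<open>2\<^sup>T\<close> is coloured through the \<open>k\<close>-tuple of top bits in which consecutive members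
  differ.  Each step at most doubles the size of a monochromatic set, up to an additive constant.

  To make the colouring semi-algebraic, an integer \<open>v\<close> is represented by the point
  \<open>\<Sum> M\<^sup>i \<cdot> (1, p\<^sub>i)\<close> over the bits \<open>i\<close> of \<open>v\<close>, where the \<open>p\<^sub>i\<close> are the points of the previous level.
  For large \<open>M\<close> the difference of two points is nearly a positive multiple of \<open>(1, p\<^sub>i)\<close>, with \<open>i\<close>
  the top differing bit.  Read as homogeneous coordinates, it is therefore close to \<open>p\<^sub>i\<close>.  Hence the
  colour is determined by signs of polynomials that depend on \<open>k\<close> only.\<close>

subsection \<open>The stepping-up colouring\<close>

text \<open>For \<open>x \<noteq> y\<close> this is the position of the highest binary digit in
  which they differ, the usual delta of the stepping-up lemma; the default is
  \<open>top_diff_bit x x = 0\<close>.\<close>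

definition top_diff_bit :: "nat \<Rightarrow> nat \<Rightarrow> nat" where
  "top_diff_bit x y = (LEAST i. x div 2 ^ Suc i = y div 2 ^ Suc i)"

lemma top_diff_bit_le_iff:
  "top_diff_bit x y \<le> i \<longleftrightarrow> x div 2 ^ Suc i = y div 2 ^ Suc i"
proof
  \<comment> \<open>Truncation by \<open>x + y + 1\<close> digits turns both numbers into 0, so the
    minimum is attained.\<close>
  have "x div 2 ^ Suc (x + y) = 0" "y div 2 ^ Suc (x + y) = 0"
    by (rule div_less, rule le_less_trans[OF _ less_exp], simp)+
  then have "x div 2 ^ Suc (x + y) = y div 2 ^ Suc (x + y)"
    by simp
  then have *: "x div 2 ^ Suc (top_diff_bit x y) = y div 2 ^ Suc (top_diff_bit x y)"
    unfolding top_diff_bit_def by (rule LeastI)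
  assume le: "top_diff_bit x y \<le> i"
  have "z div 2 ^ Suc i = z div 2 ^ Suc (top_diff_bit x y) div 2 ^ (i - top_diff_bit x y)" for z :: nat
    using le by (simp add: div_mult2_eq[symmetric] power_add[symmetric] del: power_Suc)
  then show "x div 2 ^ Suc i = y div 2 ^ Suc i"
    using * by simp
qed (auto simp: top_diff_bit_def intro: Least_le)

text \<open>Truncation is monotone: if the truncations of \<open>x\<close> and \<open>z\<close>
  agree, that of \<open>y\<close> is squeezed between them.\<close>

lemma top_diff_bit_max:
  assumes "x \<le> y" "y \<le> z"
  shows "top_diff_bit x z = max (top_diff_bit x y) (top_diff_bit y z)"
proof (rule antisym)
  have *: "top_diff_bit x z \<le> i \<longleftrightarrow> top_diff_bit x y \<le> i \<and> top_diff_bit y z \<le> i" for i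
    using div_le_mono[OF assms(1), of "2 ^ Suc i"] div_le_mono[OF assms(2), of "2 ^ Suc i"]
    unfolding top_diff_bit_le_iff by linarith
  show "top_diff_bit x z \<le> max (top_diff_bit x y) (top_diff_bit y z)"
    using *[of "max (top_diff_bit x y) (top_diff_bit y z)"] by simp
  show "max (top_diff_bit x y) (top_diff_bit y z) \<le> top_diff_bit x z"
    using *[of "top_diff_bit x z"] by simp
qed

text \<open>Above this position all digits agree and here they differ, so the order of
  \<open>x\<close> and \<open>y\<close> decides which of them has the digit 0.\<close>

lemma top_diff_bit_digits:
  assumes "x < y"
  shows "x div 2 ^ top_diff_bit x y mod 2 = 0" "y div 2 ^ top_diff_bit x y mod 2 = 1"
proof -
  define i where "i = top_diff_bit x y"
  have 1: "x div 2 ^ i div 2 = y div 2 ^ i div 2"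
    using top_diff_bit_le_iff[of x y i] by (simp add: i_def div_mult2_eq[symmetric] mult.commute)
  have 2: "x div 2 ^ i \<noteq> y div 2 ^ i"
  proof (cases i)
    case 0
    then show ?thesis using assms by simp
  next
    case (Suc j)
    then show ?thesis
      using top_diff_bit_le_iff[of x y j] i_def by auto
  qed
  have 3: "x div 2 ^ i \<le> y div 2 ^ i"
    using assms by (simp add: div_le_mono)
  have "a mod 2 = 0 \<and> b mod 2 = 1" if "a div 2 = b div 2" "a \<noteq> b" "a \<le> b" for a b :: nat
    using that by presburger
  from this[OF 1 2 3] have "x div 2 ^ i mod 2 = 0 \<and> y div 2 ^ i mod 2 = 1" .
  then show "x div 2 ^ top_diff_bit x y mod 2 = 0" "y div 2 ^ top_diff_bit x y mod 2 = 1"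
    by (auto simp: i_def)
qed

text \<open>At a common position \<open>y\<close> would need the digit 1 as the larger number and
  the digit 0 as the smaller one.\<close>

lemma top_diff_bit_neq:
  assumes "x < y" "y < z"
  shows "top_diff_bit x y \<noteq> top_diff_bit y z"
  using top_diff_bit_digits(2)[OF assms(1)] top_diff_bit_digits(1)[OF assms(2)] by auto

lemma top_diff_bit_less:
  assumes "x < y" "y < 2 ^ T"
  shows "top_diff_bit x y < T"
proof (rule ccontr)
  assume "\<not> top_diff_bit x y < T"
  then have "y < 2 ^ top_diff_bit x y"
    using assms(2) by (meson less_le_trans not_less one_le_numeral power_increasing)
  then show False
    using top_diff_bit_digits(2)[OF assms(1)] by simp
qed

section \<open>Step sequences and the recursive colouring\<close>

fun steps :: "('a \<Rightarrow> 'a \<Rightarrow> 'b) \<Rightarrow> 'a list \<Rightarrow> 'b list" where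
  "steps D (x # y # zs) = D x y # steps D (y # zs)"
| "steps D _ = []"

lemma length_steps [simp]: "length (steps D xs) = length xs - 1"
  by (induction D xs rule: steps.induct) auto

lemma nth_steps: "Suc i < length xs \<Longrightarrow> steps D xs ! i = D (xs ! i) (xs ! Suc i)"
proof (induction D xs arbitrary: i rule: steps.induct)
  case (1 D x y zs)
  then show ?case by (cases i) auto
qed auto

lemma steps_take: "steps D (take (Suc n) xs) = take n (steps D xs)"
  by (rule nth_equalityI) (auto simp: nth_steps less_diff_conv)

lemma steps_drop: "steps D (drop n xs) = drop n (steps D xs)"
  by (rule nth_equalityI) (auto simp: nth_steps less_diff_conv)

lemma set_steps_less:
  assumes "sorted_wrt (<) v" "set v \<subseteq> {..<2 ^ T}"
  shows "set (steps top_diff_bit v) \<subseteq> {..<T}"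
proof
  fix d assume "d \<in> set (steps top_diff_bit v)"
  then obtain i where i: "Suc i < length v" "d = top_diff_bit (v ! i) (v ! Suc i)"
    by (auto simp: in_set_conv_nth nth_steps less_diff_conv)
  have "v ! i < v ! Suc i"
    using assms(1) i(1) by (simp add: sorted_wrt_iff_nth_less)
  moreover have "v ! Suc i < 2 ^ T"
    using assms(2) i(1) nth_mem by blast
  ultimately show "d \<in> {..<T}"
    using i(2) top_diff_bit_less by simp
qed

lemma steps_adjacent_neq:
  assumes "sorted_wrt (<) v" "Suc (Suc i) < length v"
  shows "steps top_diff_bit v ! i \<noteq> steps top_diff_bit v ! Suc i"
  using assms by (simp add: nth_steps sorted_wrt_iff_nth_less top_diff_bit_neq)

text \<open>Adding \<open>\<not>\<close> in the decreasing case makes the case \<open>k = 2\<close> (colour of a triple: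
  whether its two steps increase) an instance of the general recursion.\<close>

primrec step_up :: "('a \<Rightarrow> 'a \<Rightarrow> bool) \<Rightarrow> ('a \<Rightarrow> 'a \<Rightarrow> 'a) \<Rightarrow> nat \<Rightarrow> 'a list \<Rightarrow> bool" where
  "step_up lt D 0 v = True"
| "step_up lt D (Suc k) v = (let ds = steps D v in
     if k < 2 then True
     else if successively lt ds then step_up lt D k ds
     else if successively (\<lambda>x y. lt y x) ds then \<not> step_up lt D k (rev ds)
     else lt (ds ! 0) (ds ! 1))"

abbreviation nat_colour :: "nat \<Rightarrow> nat list \<Rightarrow> bool" where
  "nat_colour \<equiv> step_up (<) top_diff_bit"

text \<open>The recursion starts from a constant colouring of pairs, so at this level only the size
  of the ground set bounds a monochromatic set.\<close>

lemma nat_colour_2 [simp]: "nat_colour 2 v"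
  by (simp add: numeral_2_eq_2)

lemma successively_less_iff: "successively (<) (v::nat list) \<longleftrightarrow> sorted_wrt (<) v"
  by (rule successively_conv_sorted_wrt) (simp add: transp_def)

section \<open>Realizing subsequences of monotone step sequences\<close>

lemma sorted_wrt_subseq: "subseq xs ys \<Longrightarrow> sorted_wrt P ys \<Longrightarrow> sorted_wrt P xs"
  by (induction rule: list_emb.induct) (auto dest: list_emb_set)

lemma subseq_rev: "subseq xs ys \<Longrightarrow> subseq (rev xs) (rev ys)"
  by (induction rule: list_emb.induct) (auto intro: list_emb_append_mono subseq_rev_drop_many)

lemma subseq_Nil_iff [simp]: "subseq xs [] \<longleftrightarrow> xs = []"
  by (auto elim: list_emb.cases)

lemma set_mono_subseq: "subseq xs ys \<Longrightarrow> set xs \<subseteq> set ys"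
  by (auto dest: list_emb_set)

text \<open>A step across a gap is the largest step inside it, which for increasing steps is the
  last. Hence it suffices to keep \<open>x\<close> and the right end of every chosen step. Fixing
  \<open>x\<close> as the first member makes the induction work.\<close>

lemma subseq_steps_increasing:
  assumes "sorted_wrt (<) (x # zs)" "sorted_wrt (<) (steps top_diff_bit (x # zs))"
    and "subseq us (steps top_diff_bit (x # zs))"
  shows "\<exists>xs. subseq xs zs \<and> steps top_diff_bit (x # xs) = us"
  using assms
proof (induction zs arbitrary: x us)
  case Nil
  then show ?case by auto
next
  case (Cons y zs)
  let ?d = "top_diff_bit"
  have IH: "\<exists>xs. subseq xs zs \<and> steps ?d (y # xs) = us'" if "subseq us' (steps ?d (y # zs))" for us'
    using Cons.IH[of y us'] Cons.prems that by auto
  show ?case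
  proof (cases "subseq us (steps ?d (y # zs))")
    case True
    then obtain xs where xs: "subseq xs zs" "steps ?d (y # xs) = us"
      using IH by blast
    have "steps ?d (x # xs) = us"
    proof (cases xs)
      case (Cons z ws)
      \<comment> \<open>\<open>y\<close> and \<open>z\<close> need not be neighbours in the original
        list, but their step is one of the later original steps and so exceeds
        \<open>?d x y\<close>. The start can therefore move from \<open>y\<close> back to
        \<open>x\<close>.\<close>
      have "?d y z \<in> set us"
        using xs Cons by auto
      then have "?d y z \<in> set (steps ?d (y # zs))"
        using True by (meson set_mono_subseq subsetD)
      then have "?d x y < ?d y z"
        using Cons.prems(2) by simp
      moreover have "z \<in> set zs"
        using xs(1) Cons set_mono_subseq by fastforce
      then have "?d x z = max (?d x y) (?d y z)"
        using Cons.prems(1) by (intro top_diff_bit_max) auto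
      ultimately show ?thesis
        using xs(2) Cons by auto
    qed (use xs in auto)
    then show ?thesis
      using xs(1) by blast
  next
    case False
    then obtain us' where us': "us = ?d x y # us'" "subseq us' (steps ?d (y # zs))"
      using Cons.prems(3) by (auto elim: list_emb.cases)
    then obtain xs where "subseq xs zs" "steps ?d (y # xs) = us'"
      using IH by blast
    then show ?thesis
      using us' by (intro exI[of _ "y # xs"]) auto
  qed
qed

lemma top_diff_bit_less_if_steps_less:
  assumes "sorted_wrt (<) (y # zs)" "\<forall>d\<in>set (steps top_diff_bit (y # zs)). d < b" "z \<in> set zs"
  shows "top_diff_bit y z < b"
  using assms
proof (induction zs arbitrary: y)
  case (Cons w zs)
  show ?case
  proof (cases "z = w")
    case False
    then have "top_diff_bit w z < b"
      using Cons by auto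
    moreover have "top_diff_bit y z = max (top_diff_bit y w) (top_diff_bit w z)"
      using Cons.prems False by (intro top_diff_bit_max) auto
    ultimately show ?thesis
      using Cons.prems by auto
  qed (use Cons in auto)
qed auto

text \<open>Now the largest step inside a gap is the first, so left ends are kept. Requiring
  \<open>xs \<noteq> []\<close> supplies the end point of the last chosen step.\<close>

lemma subseq_steps_decreasing:
  assumes "sorted_wrt (<) v" "v \<noteq> []" "sorted_wrt (>) (steps top_diff_bit v)"
    and "subseq us (steps top_diff_bit v)"
  shows "\<exists>xs. xs \<noteq> [] \<and> subseq xs v \<and> steps top_diff_bit xs = us"
  using assms
proof (induction v arbitrary: us rule: induct_list012)
  case (2 x)
  then show ?case by (intro exI[of _ "[x]"]) auto
next
  case (3 x y zs)
  let ?d = "top_diff_bit"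
  have IH: "\<exists>xs. xs \<noteq> [] \<and> subseq xs (y # zs) \<and> steps ?d xs = us'"
    if "subseq us' (steps ?d (y # zs))" for us'
    using 3 that by auto
  show ?case
  proof (cases "subseq us (steps ?d (y # zs))")
    case True
    then show ?thesis
      using IH by (meson list_emb_Cons)
  next
    case False
    then obtain us' where us': "us = ?d x y # us'" "subseq us' (steps ?d (y # zs))"
      using 3 by (auto elim: list_emb.cases)
    then obtain xs where xs: "xs \<noteq> []" "subseq xs (y # zs)" "steps ?d xs = us'"
      using IH by blast
    then obtain z ws where zws: "xs = z # ws"
      by (cases xs) auto
    \<comment> \<open>Whichever later member \<open>z\<close> comes next, \<open>?d y z\<close>
      stays below \<open>?d x y\<close> and does not affect the maximum.\<close>
    have "?d x z = ?d x y"
    proof (cases "z = y")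
      case False
      then have z: "z \<in> set zs"
        using xs(2) zws set_mono_subseq by fastforce
      then have "?d y z < ?d x y"
        using 3 by (intro top_diff_bit_less_if_steps_less[of y zs]) auto
      moreover have "?d x z = max (?d x y) (?d y z)"
        using 3 z by (intro top_diff_bit_max) auto
      ultimately show ?thesis by simp
    qed auto
    then show ?thesis
      using xs us' zws by (intro exI[of _ "x # xs"]) auto
  qed
qed auto

section \<open>The length of monochromatic sequences\<close>

definition monochrome :: "('a list \<Rightarrow> bool) \<Rightarrow> nat \<Rightarrow> bool \<Rightarrow> 'a list \<Rightarrow> bool" where
  "monochrome \<chi> k c v \<longleftrightarrow> (\<forall>us. subseq us v \<longrightarrow> length us = k \<longrightarrow> \<chi> us = c)"

lemma monochrome_subseq: "monochrome \<chi> k c v \<Longrightarrow> subseq w v \<Longrightarrow> monochrome \<chi> k c w"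
  unfolding monochrome_def using subseq_order.trans by blast

lemma subseq_take_drop: "subseq (take n (drop m xs)) xs"
  by (meson prefix_imp_subseq subseq_order.trans suffix_drop suffix_imp_subseq take_is_prefix)

text \<open>Every \<open>k\<close>-tuple of steps is the full step sequence of some
  \<open>(k+1)\<close>-tuple from \<open>v\<close>, and on increasing steps the recursion just
  passes the colour down.\<close>

lemma monochrome_steps_increasing:
  assumes "k \<ge> 2" "sorted_wrt (<) v" "sorted_wrt (<) (steps top_diff_bit v)"
    and "monochrome (nat_colour (Suc k)) (Suc k) c v"
  shows "monochrome (nat_colour k) k c (steps top_diff_bit v)"
  unfolding monochrome_def
proof (intro allI impI)
  fix us assume us: "subseq us (steps top_diff_bit v)" "length us = k"
  then obtain x zs where v: "v = x # zs"
    using assms(1) by (cases v) auto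
  then obtain xs where xs: "subseq xs zs" "steps top_diff_bit (x # xs) = us"
    using subseq_steps_increasing us assms by blast
  have "length (x # xs) = Suc k"
    using us(2) xs(2) by auto
  then have "nat_colour (Suc k) (x # xs) = c"
    using assms(4) v xs(1) unfolding monochrome_def by (meson subseq_Cons2)
  moreover have "sorted_wrt (<) us"
    using us(1) assms(3) by (rule sorted_wrt_subseq)
  ultimately show "nat_colour k us = c"
    using assms(1) xs(2) by (simp add: Let_def successively_less_iff)
qed

text \<open>As in the increasing case, but the recursion reverses the steps and negates the colour;
  this is why \<open>monochrome\<close> names its colour.\<close>

lemma monochrome_steps_decreasing:
  assumes "k \<ge> 2" "sorted_wrt (<) v" "sorted_wrt (>) (steps top_diff_bit v)"
    and "monochrome (nat_colour (Suc k)) (Suc k) c v"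
  shows "monochrome (nat_colour k) k (\<not> c) (rev (steps top_diff_bit v))"
  unfolding monochrome_def
proof (intro allI impI)
  fix ws assume ws: "subseq ws (rev (steps top_diff_bit v))" "length ws = k"
  define us where "us = rev ws"
  have us: "subseq us (steps top_diff_bit v)" "length us = k"
    using ws subseq_rev[OF ws(1)] by (auto simp: us_def)
  have "v \<noteq> []"
    using assms(1) us by auto
  then obtain xs where xs: "xs \<noteq> []" "subseq xs v" "steps top_diff_bit xs = us"
    using subseq_steps_decreasing us assms by blast
  have "length xs = Suc k"
    using us(2) xs(1,3) assms(1) by auto
  then have c: "nat_colour (Suc k) xs = c"
    using assms(4) xs(2) unfolding monochrome_def by blast
  have dec: "sorted_wrt (>) us"
    using us(1) assms(3) by (rule sorted_wrt_subseq)
  then have "successively (>) us" "us ! 0 > us ! 1"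
    using us(2) assms(1) by (auto simp: successively_if_sorted_wrt sorted_wrt_iff_nth_less)
  \<comment> \<open>The recursion tests for increase first; two or more steps cannot pass both
    tests.\<close>
  moreover from this have "\<not> successively (<) us"
    using us(2) assms(1) by (metis Suc_1 Suc_le_eq not_less_iff_gr_or_eq successively_nth One_nat_def)
  ultimately show "nat_colour k ws = (\<not> c)"
    using assms(1) xs(3) c by (auto simp: Let_def us_def)
qed

text \<open>Colour \<open>c\<close> forbids one kind of local extremum among the steps: valleys if
  \<open>c\<close> holds, peaks otherwise. A monotone run of \<open>h + 1\<close> steps would
  violate the bound of the previous level, so the first \<open>h + 1\<close> steps contain a move in
  the direction that can no longer turn. It persists and makes the steps from \<open>h\<close> to
  \<open>2 * h\<close> monotone, a contradiction.\<close>

lemma length_monochrome_step: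
  assumes k: "k \<ge> 2" and v: "sorted_wrt (<) v" "set v \<subseteq> {..<2 ^ T}"
    and mono: "monochrome (nat_colour (Suc k)) (Suc k) c v"
    and bound: "\<And>w c. sorted_wrt (<) w \<Longrightarrow> set w \<subseteq> {..<T} \<Longrightarrow> monochrome (nat_colour k) k c w
      \<Longrightarrow> length w \<le> h"
  shows "length v < 2 * h + k"
proof (rule ccontr)
  assume "\<not> length v < 2 * h + k"
  then have len: "length v \<ge> 2 * h + k" by simp
  define f where "f = (\<lambda>i. steps top_diff_bit v ! i)"
  have neq: "f i \<noteq> f (Suc i)" if "Suc (Suc i) < length v" for i
    using steps_adjacent_neq[OF v(1) that] by (simp add: f_def)
  have block: "\<not> (sorted_wrt (<) (map f [a..<a + Suc h]) \<or> sorted_wrt (>) (map f [a..<a + Suc h]))"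
    if "a \<le> h" for a
  proof
    define w where "w = take (Suc (Suc h)) (drop a v)"
    have sub: "subseq w v"
      unfolding w_def by (rule subseq_take_drop)
    have w: "steps top_diff_bit w = map f [a..<a + Suc h]"
      unfolding w_def steps_take steps_drop f_def
      by (rule nth_equalityI) (use that len k in \<open>auto simp del: upt_Suc\<close>)
    have s: "sorted_wrt (<) w" "set w \<subseteq> {..<2 ^ T}"
      using sub v set_mono_subseq[OF sub] by (auto intro: sorted_wrt_subseq)
    note m = monochrome_subseq[OF mono sub]
    have l: "length (steps top_diff_bit w) = Suc h"
      unfolding w by simp
    assume "sorted_wrt (<) (map f [a..<a + Suc h]) \<or> sorted_wrt (>) (map f [a..<a + Suc h])"
    then consider "sorted_wrt (<) (steps top_diff_bit w)" | "sorted_wrt (>) (steps top_diff_bit w)"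
      unfolding w by blast
    then show False
    proof cases
      case 1
      then show ?thesis
        using bound[OF 1 set_steps_less[OF s] monochrome_steps_increasing[OF k s(1) 1 m]] l by simp
    next
      case 2
      then show ?thesis
        using bound[OF _ _ monochrome_steps_decreasing[OF k s(1) 2 m]] set_steps_less[OF s] l
        by (simp add: sorted_wrt_rev)
    qed
  qed
  \<comment> \<open>A tuple whose steps begin with an extremum is coloured by whether the first two
    steps ascend: a valley gives \<open>False\<close>, a peak gives \<open>True\<close>.\<close>
  have window: "\<not> (if c then f i > f (Suc i) \<and> f (Suc i) < f (Suc (Suc i))
      else f i < f (Suc i) \<and> f (Suc i) > f (Suc (Suc i)))" if i: "Suc (Suc i) \<le> 2 * h" for i
  proof
    define w where "w = take (Suc k) (drop i v)"
    assume ext: "if c then f i > f (Suc i) \<and> f (Suc i) < f (Suc (Suc i))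
      else f i < f (Suc i) \<and> f (Suc i) > f (Suc (Suc i))"
    have "subseq w v"
      unfolding w_def by (rule subseq_take_drop)
    moreover have "length w = Suc k"
      unfolding w_def using i len by simp
    ultimately have col: "nat_colour (Suc k) w = c"
      using mono unfolding monochrome_def by blast
    have wf: "steps top_diff_bit w ! j = f (i + j)" if "j < k" for j
      unfolding w_def steps_take steps_drop f_def using i len that by auto
    have lw: "length (steps top_diff_bit w) = k"
      using \<open>length w = Suc k\<close> by simp
    define ds where "ds = steps top_diff_bit w"
    have ds0: "ds ! 0 = f i" "ds ! 1 = f (Suc i)"
      using wf[of 0] wf[of 1] k by (auto simp: ds_def)
    show False
    proof (cases "k = 2")
      \<comment> \<open>Only two steps exist, so the tuple is monotone. The constant colour of pairs
        and the negation for decreasing steps give the same colour as the extremum rule.\<close>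
      case True
      then have "ds = [f i, f (Suc i)]"
        using lw ds0 by (auto simp: ds_def[symmetric] length_Suc_conv numeral_2_eq_2)
      then show ?thesis
        using col ext unfolding True step_up.simps ds_def[symmetric]
        by (auto simp: Let_def split: if_splits)
    next
      case False
      then have ds2: "ds ! Suc 1 = f (Suc (Suc i))" "k > 2"
        using wf[of 2] k by (auto simp: ds_def numeral_2_eq_2)
      have "\<not> successively (<) ds" "\<not> successively (>) ds"
        using ext ds0 ds2 lw successively_nth[of "(<)" ds 0] successively_nth[of "(<)" ds 1]
          successively_nth[of "(>)" ds 0] successively_nth[of "(>)" ds 1]
        by (auto simp: ds_def[symmetric] split: if_splits)
      then show ?thesis
        using col ext ds0 ds2 by (auto simp: Let_def ds_def[symmetric] split: if_splits)
    qed
  qed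
  \<comment> \<open>Orienting the order by \<open>c\<close> treats both colours at once: with
    respect to \<open>lt\<close>, valleys are forbidden.\<close>
  define lt where "lt = (\<lambda>x y::nat. if c then x < y else x > y)"
  have trans: "transp lt" "transp (\<lambda>x y. lt y x)"
    by (auto simp: lt_def transp_def)
  have lt_cases: "sorted_wrt lt w \<or> sorted_wrt (\<lambda>x y. lt y x) w
      \<Longrightarrow> sorted_wrt (<) w \<or> sorted_wrt (>) w" for w
    unfolding lt_def by (cases c) auto
  have "\<not> sorted_wrt lt (map f [0..<0 + Suc h])"
    using block[of 0] lt_cases by blast
  then have "\<not> successively lt (map f [0..<0 + Suc h])"
    using successively_conv_sorted_wrt[OF trans(1)] by blast
  then obtain i where i: "i < h" "\<not> lt (f i) (f (Suc i))"
    by (auto simp: successively_conv_nth simp del: upt_Suc)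
  \<comment> \<open>Without valleys a descent cannot turn; neighbouring steps are distinct, so not
    ascending means descending.\<close>
  have "lt (f (Suc j)) (f j)" if "i \<le> j" "Suc j \<le> 2 * h" for j
    using that
  proof (induction j rule: dec_induct)
    case base
    then show ?case
      using i neq[of i] len k by (auto simp: lt_def split: if_splits)
  next
    case (step j)
    then show ?case
      using window[of j] neq[of "Suc j"] len k by (auto simp: lt_def split: if_splits)
  qed
  then have "successively (\<lambda>x y. lt y x) (map f [h..<h + Suc h])"
    using i by (auto simp: successively_conv_nth simp del: upt_Suc)
  then have "sorted_wrt (\<lambda>x y. lt y x) (map f [h..<h + Suc h])"
    using successively_conv_sorted_wrt[OF trans(2)] by blast
  then show False
    using block[of h] lt_cases by blast
qed

text \<open>For \<open>k \<ge> 2\<close> this is \<open>twr (k - 1)\<close> on natural numbers,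
  indexed by the uniformity \<open>k\<close>; below 2 the value is a default.\<close>

fun tower :: "nat \<Rightarrow> nat \<Rightarrow> nat" where
  "tower (Suc (Suc (Suc k))) N = 2 ^ tower (Suc (Suc k)) N"
| "tower _ N = N"

lemma tower_Suc: "k \<ge> 2 \<Longrightarrow> tower (Suc k) N = 2 ^ tower k N"
  by (cases k; cases "k - 1") auto

text \<open>Each level doubles the bound and adds less than \<open>k\<close>; replacing
  \<open>N + k\<close> by \<open>N + Suc k\<close> leaves room for that.\<close>

lemma length_monochrome:
  assumes "k \<ge> 2" "sorted_wrt (<) v" "set v \<subseteq> {..<tower k N}" "monochrome (nat_colour k) k c v"
  shows "length v \<le> 2 ^ k * (N + k)"
  using assms
proof (induction k arbitrary: v c rule: dec_induct)
  case base
  then have "length v = card (set v)"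
    by (simp add: distinct_card strict_sorted_iff)
  also have "\<dots> \<le> card {..<N}"
    using base by (intro card_mono) (auto simp: numeral_2_eq_2)
  finally show ?case by simp
next
  case (step k)
  have "length v < 2 * (2 ^ k * (N + k)) + k"
    using step.prems step.hyps
    by (intro length_monochrome_step[of k v "tower k N" c] step.IH) (simp_all add: tower_Suc del: step_up.simps)
  also have "\<dots> \<le> 2 ^ Suc k * (N + Suc k)"
    using less_exp[of k] by (simp add: algebra_simps del: less_exp)
  finally show ?case by simp
qed

subsection \<open>Geometric realization\<close>

text \<open>In homogeneous coordinates with positive weights at index 0, \<open>cross X Y\<close> is a positive
  multiple of the difference \<open>Y - X\<close> of the affine points, again read homogeneously.\<close>

definition cross :: "(nat \<Rightarrow> real) \<Rightarrow> (nat \<Rightarrow> real) \<Rightarrow> nat \<Rightarrow> real" where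
  "cross X Y = (\<lambda>j. X 0 * Y (Suc j) - Y 0 * X (Suc j))"

text \<open>For positive weights this says \<open>X 1 / X 0 < Y 1 / Y 0\<close>, with denominators
  cleared to obtain a polynomial condition.\<close>

definition below :: "(nat \<Rightarrow> real) \<Rightarrow> (nat \<Rightarrow> real) \<Rightarrow> bool" where
  "below X Y \<longleftrightarrow> cross X Y 0 > 0"

text \<open>Homogeneous coordinates matter only up to a positive factor, so the error is measured
  relative to that factor, uniformly in all coordinates.\<close>

definition approx :: "real \<Rightarrow> (nat \<Rightarrow> real) \<Rightarrow> (nat \<Rightarrow> real) \<Rightarrow> bool" where
  "approx \<epsilon> X p \<longleftrightarrow> (\<exists>c>0. \<forall>j. \<bar>X j - c * p j\<bar> \<le> \<epsilon> * c)"

lemma approx_refl: "\<epsilon> > 0 \<Longrightarrow> approx \<epsilon> p p"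
  unfolding approx_def by (rule exI[of _ 1]) simp

lemma below_asym: "below X Y \<Longrightarrow> \<not> below Y X"
  by (simp add: below_def cross_def)

lemma product_estimate:
  fixes x y q :: real
  assumes "\<bar>x - 1\<bar> \<le> \<epsilon>" "\<bar>y - q\<bar> \<le> \<epsilon>" "\<bar>q\<bar> \<le> C" "0 \<le> \<epsilon>" "\<epsilon> \<le> 1"
  shows "\<bar>x * y - q\<bar> \<le> \<epsilon> * (C + 2)"
proof -
  have "x * y - q = (x - 1) * y + (y - q)"
    by (simp add: algebra_simps)
  then have "\<bar>x * y - q\<bar> \<le> \<bar>x - 1\<bar> * \<bar>y\<bar> + \<bar>y - q\<bar>"
    by (metis abs_mult abs_triangle_ineq)
  also have "\<dots> \<le> \<epsilon> * (C + 1) + \<epsilon>"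
    using assms by (intro add_mono mult_mono) auto
  finally show ?thesis by (simp add: algebra_simps)
qed

text \<open>For weights 1 the cross is exactly the difference of the affine parts. Dividing
  \<open>X\<close> by \<open>a\<close> and \<open>Y\<close> by \<open>b\<close> leaves two products
  with one factor near 1, each handled by \<open>product_estimate\<close>.\<close>

lemma cross_estimate:
  assumes p: "p 0 = 1" "\<And>j. \<bar>p j\<bar> \<le> C" and q: "q 0 = 1" "\<And>j. \<bar>q j\<bar> \<le> C"
    and \<epsilon>: "0 \<le> \<epsilon>" "\<epsilon> \<le> 1" and ab: "a > 0" "b > 0"
    and X: "\<And>j. \<bar>X j - a * p j\<bar> \<le> \<epsilon> * a" and Y: "\<And>j. \<bar>Y j - b * q j\<bar> \<le> \<epsilon> * b"
  shows "\<bar>cross X Y j - a * b * (q (Suc j) - p (Suc j))\<bar> \<le> a * b * (2 * \<epsilon> * (C + 2))"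
proof -
  define x where "x = (\<lambda>j. X j / a)"
  define y where "y = (\<lambda>j. Y j / b)"
  have XY: "X j = a * x j" "Y j = b * y j" for j
    using ab by (auto simp: x_def y_def)
  have x: "\<bar>x j - p j\<bar> \<le> \<epsilon>" for j
  proof -
    have "a * \<bar>x j - p j\<bar> \<le> a * \<epsilon>"
      using X[of j] ab(1) unfolding XY right_diff_distrib[symmetric] by (simp add: abs_mult mult.commute)
    then show ?thesis using ab(1) by simp
  qed
  have y: "\<bar>y j - q j\<bar> \<le> \<epsilon>" for j
  proof -
    have "b * \<bar>y j - q j\<bar> \<le> b * \<epsilon>"
      using Y[of j] ab(2) unfolding XY right_diff_distrib[symmetric] by (simp add: abs_mult mult.commute)
    then show ?thesis using ab(2) by simp
  qed
  have "\<bar>x 0 * y (Suc j) - q (Suc j)\<bar> \<le> \<epsilon> * (C + 2)"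
    using x[of 0] p(1) by (intro product_estimate y q \<epsilon>) auto
  moreover have "\<bar>y 0 * x (Suc j) - p (Suc j)\<bar> \<le> \<epsilon> * (C + 2)"
    using y[of 0] q(1) by (intro product_estimate x p \<epsilon>) auto
  ultimately have "\<bar>x 0 * y (Suc j) - y 0 * x (Suc j) - (q (Suc j) - p (Suc j))\<bar> \<le> 2 * \<epsilon> * (C + 2)"
    by linarith
  then have "a * b * \<bar>x 0 * y (Suc j) - y 0 * x (Suc j) - (q (Suc j) - p (Suc j))\<bar>
      \<le> a * b * (2 * \<epsilon> * (C + 2))"
    using ab by (intro mult_left_mono) auto
  moreover have "cross X Y j - a * b * (q (Suc j) - p (Suc j))
      = a * b * (x 0 * y (Suc j) - y 0 * x (Suc j) - (q (Suc j) - p (Suc j)))"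
    by (simp add: cross_def XY algebra_simps)
  ultimately show ?thesis
    using ab by (simp add: abs_mult)
qed

text \<open>Colours and order must survive perturbation, because the next level recovers the points
  \<open>p i\<close> only approximately, as rescaled differences. The bound \<open>C\<close> allows
  the next scale \<open>M\<close> to be chosen; the zero tail keeps the dimension at
  \<open>k\<close>.\<close>

definition realizes :: "nat \<Rightarrow> nat \<Rightarrow> real \<Rightarrow> (nat \<Rightarrow> nat \<Rightarrow> real) \<Rightarrow> bool" where
  "realizes k T \<epsilon> p \<longleftrightarrow> 0 < \<epsilon> \<and> \<epsilon> < 1 \<and> (\<exists>C. \<forall>i<T. \<forall>j. \<bar>p i j\<bar> \<le> C) \<and>
     (\<forall>i<T. p i 0 = 1 \<and> (\<forall>j\<ge>k. p i j = 0)) \<and>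
     (\<forall>i j X Y. i < j \<longrightarrow> j < T \<longrightarrow> approx \<epsilon> X (p i) \<longrightarrow> approx \<epsilon> Y (p j) \<longrightarrow> below X Y) \<and>
     (\<forall>v Xs. length v = k \<longrightarrow> sorted_wrt (<) v \<longrightarrow> set v \<subseteq> {..<T} \<longrightarrow>
        list_all2 (\<lambda>X i. approx \<epsilon> X (p i)) Xs v \<longrightarrow> step_up below cross k Xs = nat_colour k v)"

text \<open>All pairs have the same colour, so only the order has to be preserved, and integers on a
  line achieve this.\<close>

lemma realizes_base: "\<exists>\<epsilon> p. realizes 2 N \<epsilon> p"
proof -
  define p where "p = (\<lambda>(i::nat) (j::nat). if j = 0 then 1 else if j = 1 then real i else 0)"
  define C where "C = real N + 1"
  \<comment> \<open>The error in \<open>cross_estimate\<close> becomes 1/2, half of the least gap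
    between distinct integers.\<close>
  define \<epsilon> where "\<epsilon> = 1 / (4 * (C + 2))"
  have C: "\<bar>p i j\<bar> \<le> C" if "i < N" for i j
    using that by (auto simp: p_def C_def)
  have \<epsilon>: "0 < \<epsilon>" "\<epsilon> < 1" "2 * \<epsilon> * (C + 2) = 1 / 2"
    by (auto simp: \<epsilon>_def C_def field_simps)
  have "below X Y" if ij: "i < j" "j < N" and X: "approx \<epsilon> X (p i)" and Y: "approx \<epsilon> Y (p j)" for i j X Y
  proof -
    obtain a where a: "a > 0" "\<And>j. \<bar>X j - a * p i j\<bar> \<le> \<epsilon> * a"
      using X unfolding approx_def by blast
    obtain b where b: "b > 0" "\<And>l. \<bar>Y l - b * p j l\<bar> \<le> \<epsilon> * b"
      using Y unfolding approx_def by blast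
    have "\<bar>cross X Y 0 - a * b * (p j (Suc 0) - p i (Suc 0))\<bar> \<le> a * b * (2 * \<epsilon> * (C + 2))"
      using ij \<epsilon> by (intro cross_estimate a b C) (auto simp: p_def)
    moreover have "a * b * 1 \<le> a * b * (p j (Suc 0) - p i (Suc 0))"
      using ij a(1) b(1) by (intro mult_left_mono) (auto simp: p_def)
    ultimately have "cross X Y 0 \<ge> a * b / 2"
      unfolding \<epsilon>(3) by linarith
    then show ?thesis
      using mult_pos_pos[OF a(1) b(1)] unfolding below_def by linarith
  qed
  moreover have "step_up below cross 2 Xs" for Xs
    by (simp add: numeral_2_eq_2)
  moreover have "\<exists>C. \<forall>i<N. \<forall>j. \<bar>p i j\<bar> \<le> C"
    using C by blast
  moreover have "p i 0 = 1 \<and> (\<forall>j\<ge>2. p i j = 0)" for i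
    by (simp add: p_def)
  ultimately have "realizes 2 N \<epsilon> p"
    using \<epsilon>(1,2) unfolding realizes_def by simp
  then show ?thesis by blast
qed

text \<open>As \<open>M\<close> grows, the difference of two such points is dominated by the term at their
  top differing bit, so the homogeneous coordinates of \<open>p i\<close> are recovered up to scaling.\<close>

definition lift_point :: "real \<Rightarrow> nat \<Rightarrow> (nat \<Rightarrow> nat \<Rightarrow> real) \<Rightarrow> nat \<Rightarrow> nat \<Rightarrow> real" where
  "lift_point M T p v j = (case j of 0 \<Rightarrow> 1
     | Suc j' \<Rightarrow> \<Sum>i<T. real (v div 2 ^ i mod 2) * (M ^ i * p i j'))"

section \<open>Estimates for lifted points and their differences\<close>

lemma abs_lift_point_le:
  assumes "M \<ge> 1" "C \<ge> 0" "\<And>i j. i < T \<Longrightarrow> \<bar>p i j\<bar> \<le> C"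
  shows "\<bar>lift_point M T p v j\<bar> \<le> 1 + real T * (M ^ T * C)"
proof (cases j)
  case 0
  then show ?thesis using assms by (simp add: lift_point_def)
next
  case (Suc j')
  have "\<bar>\<Sum>i<T. real (v div 2 ^ i mod 2) * (M ^ i * p i j')\<bar>
      \<le> (\<Sum>i<T. \<bar>real (v div 2 ^ i mod 2) * (M ^ i * p i j')\<bar>)"
    by (rule sum_abs)
  also have "\<dots> \<le> of_nat (card {..<T}) * (M ^ T * C)"
  proof (rule sum_bounded_above)
    fix i assume "i \<in> {..<T}"
    then have "\<bar>M ^ i * p i j'\<bar> \<le> M ^ T * C"
      using assms unfolding abs_mult by (intro mult_mono) (auto intro: power_increasing)
    moreover have "\<bar>real (v div 2 ^ i mod 2)\<bar> \<le> 1"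
      by simp
    ultimately have "\<bar>real (v div 2 ^ i mod 2)\<bar> * \<bar>M ^ i * p i j'\<bar> \<le> 1 * (M ^ T * C)"
      by (intro mult_mono) auto
    then show "\<bar>real (v div 2 ^ i mod 2) * (M ^ i * p i j')\<bar> \<le> M ^ T * C"
      by (simp add: abs_mult)
  qed
  finally show ?thesis
    using Suc by (simp add: lift_point_def)
qed

text \<open>Digits above \<open>\<delta>\<close> cancel and the digit at \<open>\<delta>\<close>
  contributes the main term. Each lower digit loses at least one factor \<open>M\<close>, and by
  \<open>big\<close> all of them together stay within the error.\<close>

lemma lift_point_diff:
  assumes M: "M \<ge> 1" and C: "\<And>i j. i < T \<Longrightarrow> \<bar>p i j\<bar> \<le> C" "C \<ge> 0"
    and big: "real T * C \<le> \<eta> * M"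
    and xy: "x < y" "y < 2 ^ T"
  defines "\<delta> \<equiv> top_diff_bit x y"
  shows "\<bar>lift_point M T p y (Suc j) - lift_point M T p x (Suc j) - M ^ \<delta> * p \<delta> j\<bar> \<le> \<eta> * M ^ \<delta>"
proof -
  define d where "d = (\<lambda>i. real (y div 2 ^ i mod 2) - real (x div 2 ^ i mod 2))"
  have \<delta>: "\<delta> < T"
    unfolding \<delta>_def using xy by (rule top_diff_bit_less)
  have d\<delta>: "d \<delta> = 1"
    using top_diff_bit_digits[OF xy(1)] by (simp add: d_def \<delta>_def)
  have "lift_point M T p y (Suc j) - lift_point M T p x (Suc j) = (\<Sum>i<T. d i * (M ^ i * p i j))"
    by (simp add: lift_point_def d_def sum_subtractf left_diff_distrib)
  also have "\<dots> = d \<delta> * (M ^ \<delta> * p \<delta> j) + (\<Sum>i\<in>{..<T} - {\<delta>}. d i * (M ^ i * p i j))"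
    using \<delta> by (intro sum.remove) auto
  finally have "\<bar>lift_point M T p y (Suc j) - lift_point M T p x (Suc j) - M ^ \<delta> * p \<delta> j\<bar>
      = \<bar>\<Sum>i\<in>{..<T} - {\<delta>}. d i * (M ^ i * p i j)\<bar>"
    using d\<delta> by simp
  also have "\<dots> \<le> (\<Sum>i\<in>{..<T} - {\<delta>}. \<bar>d i * (M ^ i * p i j)\<bar>)"
    by (rule sum_abs)
  also have "\<dots> \<le> of_nat (card ({..<T} - {\<delta>})) * (M ^ \<delta> / M * C)"
  proof (rule sum_bounded_above)
    fix i assume i: "i \<in> {..<T} - {\<delta>}"
    show "\<bar>d i * (M ^ i * p i j)\<bar> \<le> M ^ \<delta> / M * C"
    proof (cases "i < \<delta>")
      case True
      then have "M ^ Suc i \<le> M ^ \<delta>"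
        using M by (intro power_increasing) auto
      then have Mi: "M ^ i \<le> M ^ \<delta> / M"
        using M by (simp add: field_simps)
      have "\<bar>M ^ i * p i j\<bar> \<le> M ^ \<delta> / M * C"
        using M i C Mi unfolding abs_mult by (intro mult_mono) auto
      moreover have "\<bar>d i\<bar> \<le> 1"
        unfolding d_def by (cases "even (y div 2 ^ i)"; cases "even (x div 2 ^ i)")
          (auto simp: even_iff_mod_2_eq_zero odd_iff_mod_2_eq_one)
      ultimately have "\<bar>d i\<bar> * \<bar>M ^ i * p i j\<bar> \<le> 1 * (M ^ \<delta> / M * C)"
        by (intro mult_mono) auto
      then show ?thesis by (simp add: abs_mult)
    next
      case False
      then obtain m where m: "i = Suc m" "\<delta> \<le> m"
        using i by (cases i) auto
      then have "x div 2 ^ i = y div 2 ^ i"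
        using top_diff_bit_le_iff[of x y m] by (simp add: \<delta>_def)
      then show ?thesis
        using M C by (simp add: d_def)
    qed
  qed
  also have "\<dots> \<le> real T * (M ^ \<delta> / M * C)"
    using M C \<delta> by (intro mult_right_mono) auto
  also have "\<dots> = (real T * C) * (M ^ \<delta> / M)"
    by simp
  also have "\<dots> \<le> (\<eta> * M) * (M ^ \<delta> / M)"
    using M big by (intro mult_right_mono) auto
  also have "\<dots> = \<eta> * M ^ \<delta>"
    using M by simp
  finally show ?thesis .
qed

text \<open>The colour depends on comparisons of neighbouring steps and on the previous colouring of
  the steps. Neighbouring indices are distinct, so \<open>below\<close> on the approximations agrees
  with \<open><\<close> on the indices and both sides take the same branch.\<close>

lemma step_up_cong_approx:
  assumes k: "k \<ge> 2" and real: "realizes k T \<epsilon> p"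
    and ds: "length ds = k" "set ds \<subseteq> {..<T}" "\<And>i. Suc i < k \<Longrightarrow> ds ! i \<noteq> ds ! Suc i"
      "list_all2 (\<lambda>X i. approx \<epsilon> X (p i)) Ds ds"
    and Ds: "Ds = steps cross Xs" "ds = steps top_diff_bit v"
  shows "step_up below cross (Suc k) Xs = nat_colour (Suc k) v"
proof -
  have len: "length Ds = k"
    using ds list_all2_lengthD by fastforce
  have bel: "below X Y" if "i < j" "j < T" "approx \<epsilon> X (p i)" "approx \<epsilon> Y (p j)" for i j X Y
    using real that unfolding realizes_def by blast
  have col: "step_up below cross k Xs = nat_colour k v"
    if "length v = k" "sorted_wrt (<) v" "set v \<subseteq> {..<T}" "list_all2 (\<lambda>X i. approx \<epsilon> X (p i)) Xs v" for v Xs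
    using real that unfolding realizes_def by blast
  have lt: "below (Ds ! i) (Ds ! Suc i) \<longleftrightarrow> ds ! i < ds ! Suc i"
    "below (Ds ! Suc i) (Ds ! i) \<longleftrightarrow> ds ! Suc i < ds ! i" if i: "Suc i < k" for i
  proof -
    have T: "ds ! i < T" "ds ! Suc i < T"
      using i ds(1,2) by (meson Suc_lessD lessThan_iff nth_mem subsetD)+
    have ap: "approx \<epsilon> (Ds ! i) (p (ds ! i))" "approx \<epsilon> (Ds ! Suc i) (p (ds ! Suc i))"
      using i ds(1,4) by (auto simp: list_all2_conv_all_nth)
    note * = bel[OF _ T(2) ap] bel[OF _ T(1) ap(2,1)]
    show "below (Ds ! i) (Ds ! Suc i) \<longleftrightarrow> ds ! i < ds ! Suc i"
      "below (Ds ! Suc i) (Ds ! i) \<longleftrightarrow> ds ! Suc i < ds ! i"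
      using * ds(3)[OF i] below_asym by (meson linorder_neqE_nat)+
  qed
  have inc: "successively below Ds \<longleftrightarrow> successively (<) ds"
    using lt len ds(1) by (auto simp: successively_conv_nth)
  have dec: "successively (\<lambda>x y. below y x) Ds \<longleftrightarrow> successively (>) ds"
    using lt len ds(1) by (auto simp: successively_conv_nth)
  have "step_up below cross k Ds = nat_colour k ds" if "successively (<) ds"
    using that ds by (intro col) (auto simp: successively_less_iff)
  moreover have "step_up below cross k (rev Ds) = nat_colour k (rev ds)" if "successively (>) ds"
  proof -
    have "sorted_wrt (>) ds"
      using that successively_conv_sorted_wrt[of "(>)" ds] by (simp add: transp_def)
    then show ?thesis
      using ds by (intro col) (auto simp: sorted_wrt_rev)
  qed
  moreover have "below (Ds ! 0) (Ds ! 1) \<longleftrightarrow> ds ! 0 < ds ! 1"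
    using lt(1)[of 0] k by simp
  ultimately show ?thesis
    using inc dec by (simp add: Let_def Ds[symmetric])
qed

lemma realizes_step:
  assumes k: "k \<ge> 2" and real: "realizes k T \<epsilon> p"
  shows "\<exists>\<epsilon> p. realizes (Suc k) (2 ^ T) \<epsilon> p"
proof -
  obtain C0 where C0: "\<And>i j. i < T \<Longrightarrow> \<bar>p i j\<bar> \<le> C0"
    using real[unfolded realizes_def, THEN conjunct2, THEN conjunct2, THEN conjunct1] by blast
  define C where "C = max C0 0"
  have C: "\<bar>p i j\<bar> \<le> C" if "i < T" for i j
    using C0[OF that, of j] by (auto simp: C_def)
  have C_nonneg: "C \<ge> 0"
    by (simp add: C_def)
  have \<epsilon>: "0 < \<epsilon>" "\<epsilon> < 1"
    using real unfolding realizes_def by auto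
  have p0: "p i 0 = 1" if "i < T" for i
    using real that unfolding realizes_def by blast
  \<comment> \<open>Chosen so that in a difference of lifted points all bits except the top
    differing one use at most half of the tolerance \<open>\<epsilon>\<close>.\<close>
  define M where "M = 1 + real T * C / (\<epsilon> / 2)"
  have M: "M \<ge> 1"
    using C_nonneg \<epsilon> by (simp add: M_def)
  have big: "real T * C \<le> \<epsilon> / 2 * M"
    using \<epsilon> by (simp add: M_def field_simps)
  define q where "q = lift_point M T p"
  define B where "B = 1 + real T * (M ^ T * C)"
  have B: "\<bar>q v j\<bar> \<le> B" for v j
    unfolding q_def B_def using M C_nonneg C by (rule abs_lift_point_le)
  have Bpos: "B > 0"
    using M C_nonneg by (auto simp: B_def add_pos_nonneg)
  have q0: "q v 0 = 1" for v
    by (simp add: q_def lift_point_def)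
  \<comment> \<open>The new tolerance is chosen after \<open>M\<close>, since it depends on the size
    \<open>B\<close> of the lifted points; perturbations then cost at most the other half of
    \<open>\<epsilon>\<close>.\<close>
  define \<eta> where "\<eta> = min (1 / 2) (\<epsilon> / (4 * (B + 2)))"
  have \<eta>: "0 < \<eta>" "\<eta> < 1"
    using \<epsilon> Bpos by (auto simp: \<eta>_def)
  have "\<eta> \<le> \<epsilon> / (4 * (B + 2))"
    by (simp add: \<eta>_def)
  then have \<eta>B: "2 * \<eta> * (B + 2) \<le> \<epsilon> / 2"
    using Bpos by (simp add: field_simps)
  have key: "approx \<epsilon> (cross X Y) (p (top_diff_bit x y))"
    if xy: "x < y" "y < 2 ^ T" and X: "approx \<eta> X (q x)" and Y: "approx \<eta> Y (q y)" for x y X Y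
  proof -
    define \<delta> where "\<delta> = top_diff_bit x y"
    obtain a where a: "a > 0" "\<And>j. \<bar>X j - a * q x j\<bar> \<le> \<eta> * a"
      using X unfolding approx_def by blast
    obtain b where b: "b > 0" "\<And>j. \<bar>Y j - b * q y j\<bar> \<le> \<eta> * b"
      using Y unfolding approx_def by blast
    have ab: "a * b > 0"
      using a b by simp
    have "\<bar>cross X Y j - a * b * M ^ \<delta> * p \<delta> j\<bar> \<le> \<epsilon> * (a * b * M ^ \<delta>)" for j
    proof -
      have 1: "\<bar>cross X Y j - a * b * (q y (Suc j) - q x (Suc j))\<bar> \<le> a * b * (2 * \<eta> * (B + 2))"
        using \<eta> by (intro cross_estimate a b B q0) auto
      have "a * b * (2 * \<eta> * (B + 2)) \<le> a * b * (\<epsilon> / 2 * M ^ \<delta>)"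
      proof (intro mult_left_mono)
        have "\<epsilon> / 2 * 1 \<le> \<epsilon> / 2 * M ^ \<delta>"
          using M \<epsilon> by (intro mult_left_mono) auto
        then show "2 * \<eta> * (B + 2) \<le> \<epsilon> / 2 * M ^ \<delta>"
          using \<eta>B by linarith
      qed (use ab in auto)
      note 1 = order_trans[OF 1 this]
      have "\<bar>q y (Suc j) - q x (Suc j) - M ^ \<delta> * p \<delta> j\<bar> \<le> \<epsilon> / 2 * M ^ \<delta>"
        unfolding q_def \<delta>_def using M C C_nonneg big xy by (rule lift_point_diff)
      then have "a * b * \<bar>q y (Suc j) - q x (Suc j) - M ^ \<delta> * p \<delta> j\<bar> \<le> a * b * (\<epsilon> / 2 * M ^ \<delta>)"
        using ab by (intro mult_left_mono) auto
      then have "\<bar>a * b * (q y (Suc j) - q x (Suc j) - M ^ \<delta> * p \<delta> j)\<bar> \<le> a * b * (\<epsilon> / 2 * M ^ \<delta>)"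
        using a(1) b(1) by (simp add: abs_mult)
      moreover have "cross X Y j - a * b * M ^ \<delta> * p \<delta> j = cross X Y j - a * b * (q y (Suc j) - q x (Suc j))
          + a * b * (q y (Suc j) - q x (Suc j) - M ^ \<delta> * p \<delta> j)"
        by (simp add: algebra_simps)
      moreover have "\<epsilon> * (a * b * M ^ \<delta>) = a * b * (\<epsilon> / 2 * M ^ \<delta>) + a * b * (\<epsilon> / 2 * M ^ \<delta>)"
        by simp
      ultimately show ?thesis
        using 1 by linarith
    qed
    moreover have "a * b * M ^ \<delta> > 0"
      using ab M by simp
    ultimately show ?thesis
      unfolding approx_def \<delta>_def by blast
  qed
  have bel: "below X Y"
    if xy: "x < y" "y < 2 ^ T" and X: "approx \<eta> X (q x)" and Y: "approx \<eta> Y (q y)" for x y X Y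
  proof -
    obtain c where c: "c > 0" "\<And>j. \<bar>cross X Y j - c * p (top_diff_bit x y) j\<bar> \<le> \<epsilon> * c"
      using key[OF xy X Y] unfolding approx_def by blast
    \<comment> \<open>The weight of the cross is within \<open>\<epsilon> * c\<close> of
      \<open>c\<close>, since \<open>p\<close> has weight 1; so \<open>\<epsilon> < 1\<close> makes
      it positive.\<close>
    have "\<epsilon> * c < 1 * c"
      using \<epsilon> c(1) by (intro mult_strict_right_mono) auto
    then show ?thesis
      using c(2)[of 0] p0[OF top_diff_bit_less[OF xy]] unfolding below_def by simp
  qed
  have col: "step_up below cross (Suc k) Xs = nat_colour (Suc k) v"
    if v: "length v = Suc k" "sorted_wrt (<) v" "set v \<subseteq> {..<2 ^ T}"
      and Xs: "list_all2 (\<lambda>X i. approx \<eta> X (q i)) Xs v" for v Xs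
  proof (rule step_up_cong_approx[OF k real _ _ _ _ refl refl])
    show "length (steps top_diff_bit v) = k"
      using v by simp
    show "set (steps top_diff_bit v) \<subseteq> {..<T}"
      using v(2,3) by (rule set_steps_less)
    show "steps top_diff_bit v ! i \<noteq> steps top_diff_bit v ! Suc i" if "Suc i < k" for i
      using v that by (intro steps_adjacent_neq) auto
    have "approx \<epsilon> (cross (Xs ! i) (Xs ! Suc i)) (p (top_diff_bit (v ! i) (v ! Suc i)))"
      if i: "i < k" for i
    proof (rule key)
      show "v ! i < v ! Suc i"
        using v i by (simp add: sorted_wrt_iff_nth_less)
      show "v ! Suc i < 2 ^ T"
        using v i nth_mem by (metis Suc_mono lessThan_iff subsetD)
    qed (use Xs v i in \<open>auto simp: list_all2_conv_all_nth\<close>)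
    then show "list_all2 (\<lambda>X i. approx \<epsilon> X (p i)) (steps cross Xs) (steps top_diff_bit v)"
      using Xs v by (auto simp: list_all2_conv_all_nth nth_steps)
  qed
  \<comment> \<open>Lifting prepends a new weight and shifts the old coordinates by one.\<close>
  have "q i j = 0" if "i < 2 ^ T" "j \<ge> Suc k" for i j
  proof -
    have "\<forall>i<T. p i (j - 1) = 0"
      using real that unfolding realizes_def by auto
    then show ?thesis
      using that by (cases j) (auto simp: q_def lift_point_def)
  qed
  then have "realizes (Suc k) (2 ^ T) \<eta> q"
    using \<eta> B q0 bel col unfolding realizes_def by blast
  then show ?thesis by blast
qed

lemma realizes_tower: "k \<ge> 2 \<Longrightarrow> \<exists>\<epsilon> p. realizes k (tower k N) \<epsilon> p"
proof (induction k rule: dec_induct)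
  case base
  then show ?case using realizes_base by (simp add: numeral_2_eq_2)
next
  case (step k)
  then show ?case using realizes_step by (auto simp: tower_Suc)
qed

subsection \<open>Semi-algebraic predicates\<close>

definition monomial_eval :: "(nat \<Rightarrow>\<^sub>0 nat) \<Rightarrow> real list \<Rightarrow> real" where
  "monomial_eval a x = (\<Prod>i\<in>Poly_Mapping.keys a. (x ! i) ^ Poly_Mapping.lookup a i)"

lemma mpoly_eval_conv_monomial_eval:
  "mpoly_eval F x = (\<Sum>a\<in>Poly_Mapping.keys F. Poly_Mapping.lookup F a * monomial_eval a x)"
  by (simp add: mpoly_eval_def monomial_eval_def)

lemma mpoly_eval_add: "mpoly_eval (F + G) x = mpoly_eval F x + mpoly_eval G x"
  unfolding mpoly_eval_conv_monomial_eval
  by (rule setsum_keys_plus_distrib) (auto simp: distrib_right)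

lemma monomial_eval_add: "monomial_eval (a + b) x = monomial_eval a x * monomial_eval b x"
proof -
  \<comment> \<open>Over a common index set all three products can be compared; the added factors
    have exponent 0.\<close>
  have eval: "monomial_eval c x = (\<Prod>i\<in>Poly_Mapping.keys a \<union> Poly_Mapping.keys b. (x ! i) ^ Poly_Mapping.lookup c i)"
    if "Poly_Mapping.keys c \<subseteq> Poly_Mapping.keys a \<union> Poly_Mapping.keys b" for c
    unfolding monomial_eval_def using that
    by (intro prod.mono_neutral_left) (auto simp: in_keys_iff)
  show ?thesis
    using eval[of a] eval[of b] eval[of "a + b"] keys_add[of a b]
    by (simp add: lookup_add power_add prod.distrib)
qed

text \<open>Degrees are not tracked here; they are bounded once the finite list of polynomials is
  known, in \<open>semialg_bounded_complexity\<close>.\<close>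

definition polyfun :: "nat \<Rightarrow> (real list \<Rightarrow> real) \<Rightarrow> bool" where
  "polyfun n f \<longleftrightarrow> (\<exists>F. mpoly_vars F \<subseteq> {..<n} \<and> (\<forall>x. f x = mpoly_eval F x))"

lemma polyfun_monomial:
  assumes "Poly_Mapping.keys a \<subseteq> {..<n}"
  shows "polyfun n (\<lambda>x. c * monomial_eval a x)"
  unfolding polyfun_def using assms
  by (intro exI[of _ "Poly_Mapping.single a c"])
    (auto simp: mpoly_vars_def mpoly_eval_conv_monomial_eval split: if_splits)

lemma polyfun_add: "polyfun n f \<Longrightarrow> polyfun n g \<Longrightarrow> polyfun n (\<lambda>x. f x + g x)"
proof -
  assume "polyfun n f" "polyfun n g"
  then obtain F G where FG: "mpoly_vars F \<subseteq> {..<n}" "mpoly_vars G \<subseteq> {..<n}"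
    "\<And>x. f x = mpoly_eval F x" "\<And>x. g x = mpoly_eval G x"
    unfolding polyfun_def by blast
  have "mpoly_vars (F + G) \<subseteq> mpoly_vars F \<union> mpoly_vars G"
    using keys_add[of F G] unfolding mpoly_vars_def by blast
  then show ?thesis
    unfolding polyfun_def using FG by (intro exI[of _ "F + G"]) (auto simp: mpoly_eval_add)
qed

lemma polyfun_const: "polyfun n (\<lambda>x. c)"
  using polyfun_monomial[of 0 n c] by (simp add: monomial_eval_def)

lemma polyfun_var: "i < n \<Longrightarrow> polyfun n (\<lambda>x. x ! i)"
  using polyfun_monomial[of "Poly_Mapping.single i 1" n 1] by (simp add: monomial_eval_def)

lemma polyfun_sum:
  assumes "\<And>i. i \<in> I \<Longrightarrow> polyfun n (f i)"
  shows "polyfun n (\<lambda>x. \<Sum>i\<in>I. f i x)"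
  using assms
  by (induction I rule: infinite_finite_induct) (auto intro: polyfun_const polyfun_add)

lemma polyfun_mult:
  assumes "polyfun n f" "polyfun n g"
  shows "polyfun n (\<lambda>x. f x * g x)"
proof -
  obtain F G where FG: "mpoly_vars F \<subseteq> {..<n}" "mpoly_vars G \<subseteq> {..<n}"
    "\<And>x. f x = mpoly_eval F x" "\<And>x. g x = mpoly_eval G x"
    using assms unfolding polyfun_def by blast
  have "f x * g x = (\<Sum>a\<in>Poly_Mapping.keys F. \<Sum>b\<in>Poly_Mapping.keys G.
      (Poly_Mapping.lookup F a * Poly_Mapping.lookup G b) * monomial_eval (a + b) x)" for x
    unfolding FG mpoly_eval_conv_monomial_eval sum_product monomial_eval_add
    by (simp add: mult_ac)
  moreover have "polyfun n (\<lambda>x. \<Sum>a\<in>Poly_Mapping.keys F. \<Sum>b\<in>Poly_Mapping.keys G.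
      (Poly_Mapping.lookup F a * Poly_Mapping.lookup G b) * monomial_eval (a + b) x)"
  proof (intro polyfun_sum polyfun_monomial)
    fix a b assume "a \<in> Poly_Mapping.keys F" "b \<in> Poly_Mapping.keys G"
    then have "Poly_Mapping.keys a \<subseteq> {..<n}" "Poly_Mapping.keys b \<subseteq> {..<n}"
      using FG unfolding mpoly_vars_def by blast+
    then show "Poly_Mapping.keys (a + b) \<subseteq> {..<n}"
      using keys_add[of a b] by blast
  qed
  ultimately show ?thesis by simp
qed

lemma polyfun_diff:
  assumes "polyfun n f" "polyfun n g"
  shows "polyfun n (\<lambda>x. f x - g x)"
  using polyfun_add[OF assms(1) polyfun_mult[OF polyfun_const[of n "-1"] assms(2)]] by simp

section \<open>Boolean combinations of polynomial sign conditions\<close>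

definition semialg :: "nat \<Rightarrow> (real list \<Rightarrow> bool) \<Rightarrow> bool" where
  "semialg n S \<longleftrightarrow> (\<exists>fs \<Phi>. (\<forall>f\<in>set fs. polyfun n f) \<and> (\<forall>x. S x \<longleftrightarrow> \<Phi> (map (\<lambda>f. f x \<ge> 0) fs)))"

lemma semialg_const: "semialg n (\<lambda>x. b)"
  unfolding semialg_def by (intro exI[of _ "[]"] exI[of _ "\<lambda>_. b"]) auto

text \<open>The two lists of polynomials are concatenated, and the new Boolean function splits the
  sign vector again.\<close>

lemma semialg_binop:
  assumes "semialg n S" "semialg n T"
  shows "semialg n (\<lambda>x. h (S x) (T x))"
proof -
  obtain fs \<Phi> where S: "\<forall>f\<in>set fs. polyfun n f" "\<And>x. S x \<longleftrightarrow> \<Phi> (map (\<lambda>f. f x \<ge> 0) fs)"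
    using assms(1) unfolding semialg_def by blast
  obtain gs \<Psi> where T: "\<forall>f\<in>set gs. polyfun n f" "\<And>x. T x \<longleftrightarrow> \<Psi> (map (\<lambda>f. f x \<ge> 0) gs)"
    using assms(2) unfolding semialg_def by blast
  show ?thesis
    unfolding semialg_def using S T
    by (intro exI[of _ "fs @ gs"] exI[of _ "\<lambda>bs. h (\<Phi> (take (length fs) bs)) (\<Psi> (drop (length fs) bs))"]) auto
qed

lemma semialg_if:
  assumes "semialg n C" "semialg n S" "semialg n T"
  shows "semialg n (\<lambda>x. if C x then S x else T x)"
proof -
  have "semialg n (\<lambda>x. (C x \<and> S x) \<or> (\<not> C x \<and> T x))"
    using semialg_binop[OF semialg_binop[OF assms(1,2), of "(\<and>)"]
        semialg_binop[OF assms(1,3), of "\<lambda>c t. \<not> c \<and> t"], of "(\<or>)"] .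
  then show ?thesis
    by (rule back_subst[of "semialg n"]) auto
qed

lemma semialg_not: "semialg n S \<Longrightarrow> semialg n (\<lambda>x. \<not> S x)"
  by (rule semialg_binop[of n S S "\<lambda>s _. \<not> s"])

text \<open>A strict inequality is the negation of a weak one for \<open>- f\<close>.\<close>

lemma semialg_pos: "polyfun n f \<Longrightarrow> semialg n (\<lambda>x. f x > 0)"
proof -
  assume "polyfun n f"
  then have "polyfun n (\<lambda>x. 0 - f x)"
    by (intro polyfun_diff polyfun_const)
  then show ?thesis
    unfolding semialg_def
    by (intro exI[of _ "[\<lambda>x. 0 - f x]"] exI[of _ "\<lambda>bs. \<not> hd bs"]) auto
qed

definition polyvec :: "nat \<Rightarrow> (real list \<Rightarrow> nat \<Rightarrow> real) \<Rightarrow> bool" where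
  "polyvec n F \<longleftrightarrow> (\<forall>j. polyfun n (\<lambda>x. F x j))"

lemma polyvec_cross: "polyvec n F \<Longrightarrow> polyvec n G \<Longrightarrow> polyvec n (\<lambda>x. cross (F x) (G x))"
  unfolding polyvec_def cross_def by (auto intro!: polyfun_diff polyfun_mult)

lemma semialg_below: "polyvec n F \<Longrightarrow> polyvec n G \<Longrightarrow> semialg n (\<lambda>x. below (F x) (G x))"
  using polyvec_cross[of n F G] unfolding below_def polyvec_def by (intro semialg_pos) auto

lemma semialg_successively:
  assumes "\<And>F G. F \<in> set Fs \<Longrightarrow> G \<in> set Fs \<Longrightarrow> semialg n (\<lambda>x. R (F x) (G x))"
  shows "semialg n (\<lambda>x. successively R (map (\<lambda>F. F x) Fs))"
  using assms
proof (induction Fs rule: induct_list012)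
  case (3 F G Fs)
  then have "semialg n (\<lambda>x. R (F x) (G x))" "semialg n (\<lambda>x. successively R (map (\<lambda>F. F x) (G # Fs)))"
    by auto
  from semialg_binop[OF this, of "(\<and>)"] show ?case by simp
qed (auto intro: semialg_const)

text \<open>The recursion is unfolded on functions of the input instead of points. Its tree of tests
  depends on \<open>k\<close> only, so finitely many polynomials serve all point sets.\<close>

lemma semialg_step_up:
  assumes "length Fs = k" "\<forall>F\<in>set Fs. polyvec n F"
  shows "semialg n (\<lambda>x. step_up below cross k (map (\<lambda>F. F x) Fs))"
  using assms
proof (induction k arbitrary: Fs)
  case 0
  then show ?case by (simp add: semialg_const)
next
  case (Suc k)
  show ?case
  proof (cases "k < 2")
    case True
    then show ?thesis by (simp add: semialg_const)
  next
    case False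
    \<comment> \<open>Steps formed symbolically; evaluating them at \<open>x\<close> gives the steps
      of the evaluated points.\<close>
    define Gs where "Gs = steps (\<lambda>F G x. cross (F x) (G x)) Fs"
    have Gs: "steps cross (map (\<lambda>F. F x) Fs) = map (\<lambda>G. G x) Gs" for x
      unfolding Gs_def by (rule nth_equalityI) (auto simp: nth_steps less_diff_conv)
    have len: "length Gs = k"
      using Suc.prems by (simp add: Gs_def)
    have pv: "polyvec n G" if G: "G \<in> set Gs" for G
    proof -
      obtain i where "Suc i < length Fs" "G = (\<lambda>x. cross ((Fs ! i) x) ((Fs ! Suc i) x))"
        using G by (auto simp: Gs_def in_set_conv_nth nth_steps less_diff_conv)
      then show ?thesis
        using Suc.prems(2) by (simp add: polyvec_cross)
    qed
    have s: "semialg n (\<lambda>x. step_up below cross k (map (\<lambda>G. G x) Gs))"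
      using len pv by (intro Suc.IH) auto
    have r: "semialg n (\<lambda>x. step_up below cross k (map (\<lambda>G. G x) (rev Gs)))"
      using len pv by (intro Suc.IH) auto
    have b: "semialg n (\<lambda>x. below ((Gs ! 0) x) ((Gs ! 1) x))"
      using len pv False by (intro semialg_below) auto
    have "semialg n (\<lambda>x. if successively below (map (\<lambda>G. G x) Gs)
        then step_up below cross k (map (\<lambda>G. G x) Gs)
        else if successively (\<lambda>X Y. below Y X) (map (\<lambda>G. G x) Gs)
        then \<not> step_up below cross k (map (\<lambda>G. G x) (rev Gs))
        else below ((Gs ! 0) x) ((Gs ! 1) x))"
      by (intro semialg_if semialg_not semialg_successively semialg_below s r b pv)
    moreover have "step_up below cross (Suc k) (map (\<lambda>F. F x) Fs)
      \<longleftrightarrow> (if successively below (map (\<lambda>G. G x) Gs)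
        then step_up below cross k (map (\<lambda>G. G x) Gs)
        else if successively (\<lambda>X Y. below Y X) (map (\<lambda>G. G x) Gs)
        then \<not> step_up below cross k (map (\<lambda>G. G x) (rev Gs))
        else below ((Gs ! 0) x) ((Gs ! 1) x))" for x
      using False len by (simp add: Let_def Gs rev_map)
    ultimately show ?thesis
      by presburger
  qed
qed

lemma semialg_bounded_complexity:
  assumes "semialg n S"
  obtains t fs \<Phi> where "t \<ge> 1" "length fs = t"
    "\<forall>F\<in>set fs. mpoly_vars F \<subseteq> {..<n} \<and> total_degree F \<le> t"
    "\<And>x. S x \<longleftrightarrow> \<Phi> (map (\<lambda>F. mpoly_eval F x \<ge> 0) fs)"
proof -
  obtain gs \<Phi> where gs: "\<forall>f\<in>set gs. polyfun n f" "\<And>x. S x \<longleftrightarrow> \<Phi> (map (\<lambda>f. f x \<ge> 0) gs)"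
    using assms unfolding semialg_def by blast
  obtain \<phi> where \<phi>: "\<And>f. f \<in> set gs \<Longrightarrow> mpoly_vars (\<phi> f) \<subseteq> {..<n} \<and> (\<forall>x. f x = mpoly_eval (\<phi> f) x)"
    using gs(1) unfolding polyfun_def by metis
  define Fs where "Fs = map \<phi> gs"
  have Fs: "\<And>x. map (\<lambda>F. mpoly_eval F x \<ge> 0) Fs = map (\<lambda>f. f x \<ge> 0) gs"
    using \<phi> by (simp add: Fs_def)
  \<comment> \<open>One number must equal the count of polynomials and bound every degree; the sum
    does both, and zero polynomials fill the list up to length \<open>t\<close>.\<close>
  define t where "t = 1 + length Fs + sum_list (map total_degree Fs)"
  define fs where "fs = Fs @ replicate (t - length Fs) 0"
  show thesis
  proof
    show "t \<ge> 1" "length fs = t"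
      by (auto simp: t_def fs_def)
    have "total_degree F \<le> t" if "F \<in> set Fs" for F
      using member_le_sum_list[of "total_degree F" "map total_degree Fs"] that
      by (auto simp: t_def)
    moreover have "mpoly_vars F \<subseteq> {..<n}" if "F \<in> set Fs" for F
      using that \<phi> by (auto simp: Fs_def)
    moreover have "mpoly_vars 0 \<subseteq> {..<n} \<and> total_degree 0 \<le> t"
      by (simp add: total_degree_def mpoly_vars_def)
    ultimately show "\<forall>F\<in>set fs. mpoly_vars F \<subseteq> {..<n} \<and> total_degree F \<le> t"
      by (auto simp: fs_def)
    have "take (length Fs) (map (\<lambda>F. mpoly_eval F x \<ge> 0) fs) = map (\<lambda>F. mpoly_eval F x \<ge> 0) Fs" for x
      by (simp add: fs_def)
    then show "S x \<longleftrightarrow> (\<lambda>bs. \<Phi> (take (length Fs) bs)) (map (\<lambda>F. mpoly_eval F x \<ge> 0) fs)" for x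
      by (simp only: gs(2) Fs)
  qed
qed

text \<open>Recovers the \<open>i\<close>-th point from a concatenated tuple; padding by 0 matches
  the zero tail in \<open>realizes\<close>.\<close>

definition block :: "nat \<Rightarrow> nat \<Rightarrow> real list \<Rightarrow> nat \<Rightarrow> real" where
  "block d i x j = (if j < d then x ! (i * d + j) else 0)"

lemma polyvec_block: "i < k \<Longrightarrow> polyvec (d * k) (block d i)"
proof -
  assume "i < k"
  have "i * d + j < d * k" if "j < d" for j
  proof -
    have "i * d + j < Suc i * d"
      using that by simp
    also have "\<dots> \<le> k * d"
      using \<open>i < k\<close> by (intro mult_le_mono1) auto
    finally show ?thesis by (simp add: mult.commute)
  qed
  then show ?thesis
    unfolding polyvec_def block_def
    by (intro allI, case_tac "j < d") (auto intro: polyfun_var polyfun_const)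
qed

lemma nth_concat_equal_lengths:
  assumes "\<forall>x\<in>set xs. length x = d" "i < length xs" "j < d"
  shows "concat xs ! (i * d + j) = xs ! i ! j"
  using assms
proof (induction xs arbitrary: i)
  case (Cons x xs)
  then show ?case
    by (cases i) (auto simp: nth_append add.assoc)
qed auto

lemma subseq_mapD: "subseq ys (map f xs) \<Longrightarrow> \<exists>us. subseq us xs \<and> ys = map f us"
  by (auto simp: subseq_conv_nths nths_map)

subsection \<open>The lower bound\<close>

text \<open>\<open>t\<close> precedes \<open>N\<close> because the predicate \<open>S\<close>
  depends on \<open>k\<close> only. All \<open>N' \<le> tower k N\<close> are covered, by the first
  \<open>N'\<close> points, since bounding a least number from below means refuting every smaller
  candidate. The weight is kept as a real coordinate, so the dimension is \<open>k\<close>.\<close>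

lemma semialg_ramsey_witness:
  assumes k: "k \<ge> 2"
  shows "\<exists>t\<ge>1. \<forall>N N'. N' \<le> tower k N \<longrightarrow> (\<exists>P E. ordered_point_set k P \<and> length P = N' \<and>
    semialgebraic_relation k t k P E \<and> hom_size k P E \<le> 2 ^ k * (N + k))"
proof -
  define S where "S = (\<lambda>x. step_up below cross k (map (\<lambda>F. F x) (map (block k) [0..<k])))"
  have "semialg (k * k) S"
    unfolding S_def by (rule semialg_step_up) (auto intro: polyvec_block)
  then obtain t fs \<Phi> where t: "t \<ge> 1" "length fs = t"
    and fs: "\<forall>F\<in>set fs. mpoly_vars F \<subseteq> {..<k * k} \<and> total_degree F \<le> t"
    and S: "\<And>x. S x \<longleftrightarrow> \<Phi> (map (\<lambda>F. mpoly_eval F x \<ge> 0) fs)"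
    by (rule semialg_bounded_complexity) blast
  have "\<exists>P E. ordered_point_set k P \<and> length P = N' \<and>
    semialgebraic_relation k t k P E \<and> hom_size k P E \<le> 2 ^ k * (N + k)" if N': "N' \<le> tower k N" for N N'
  proof -
    obtain \<epsilon> p where real: "realizes k (tower k N) \<epsilon> p"
      using realizes_tower[OF k] by blast
    have \<epsilon>: "\<epsilon> > 0"
      using real unfolding realizes_def by blast
    have p: "p i 0 = 1 \<and> (\<forall>j\<ge>k. p i j = 0)" if "i < N'" for i
      using real that N' unfolding realizes_def by (meson less_le_trans)
    have below: "below (p i) (p j)" if "i < j" "j < N'" for i j
    proof -
      have "j < tower k N" using that N' by simp
      then show ?thesis
        using real that approx_refl[OF \<epsilon>] unfolding realizes_def by meson
    qed
    define pt where "pt = (\<lambda>v. map (p v) [0..<k])"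
    \<comment> \<open>Both weights are 1, so \<open>below\<close> already separates the coordinates
      at index 1.\<close>
    have pt_neq: "pt i \<noteq> pt j" if "i < j" "j < N'" for i j
    proof
      assume "pt i = pt j"
      then have "pt i ! Suc 0 = pt j ! Suc 0" by simp
      then have "p i (Suc 0) = p j (Suc 0)"
        using k by (simp add: pt_def)
      moreover have "p i 0 = 1" "p j 0 = 1"
        using p that by auto
      ultimately show False
        using below[OF that] by (simp add: below_def cross_def)
    qed
    define P where "P = map pt [0..<N']"
    have "distinct P"
      unfolding P_def distinct_map inj_on_def using pt_neq
      by (auto) (metis linorder_neqE_nat)
    then have P: "ordered_point_set k P" "length P = N'"
      by (auto simp: ordered_point_set_def P_def pt_def)
    define E where "E = {T \<in> tuples k P. concat T \<in> semialgebraic_set (k * k) fs \<Phi>}"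
    have sorted: "sorted_wrt (<) us" "set us \<subseteq> {..<N'}" if "subseq us [0..<N']" for us
      using that sorted_wrt_subseq[OF that, of "(<)"] set_mono_subseq[OF that] by auto
    have E: "map pt us \<in> E \<longleftrightarrow> nat_colour k us" if us: "subseq us [0..<N']" "length us = k" for us
    proof -
      have "map pt us \<in> tuples k P"
        using us by (simp add: tuples_def P_def subseq_map)
      moreover have "length (concat (map pt us)) = k * k"
        using us by (simp add: length_concat pt_def o_def sum_list_triv)
      ultimately have "map pt us \<in> E \<longleftrightarrow> S (concat (map pt us))"
        by (simp add: E_def semialgebraic_set_def S)
      \<comment> \<open>Cutting the concatenation into blocks returns the vectors \<open>p\<close>
        exactly.\<close>
      also have "map (\<lambda>i. block k i (concat (map pt us))) [0..<k] = map p us"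
      proof (rule nth_equalityI)
        fix i assume "i < length (map (\<lambda>i. block k i (concat (map pt us))) [0..<k])"
        then have i: "i < k" by simp
        then have "us ! i < N'"
          using sorted(2)[OF us(1)] us(2) nth_mem by (metis lessThan_iff subsetD)
        then have "block k i (concat (map pt us)) j = p (us ! i) j" for j
          using i us(2) p nth_concat_equal_lengths[of "map pt us" k i j]
          by (auto simp: block_def pt_def)
        then show "map (\<lambda>i. block k i (concat (map pt us))) [0..<k] ! i = map p us ! i"
          using i us(2) by auto
      qed (use us in auto)
      then have "S (concat (map pt us)) \<longleftrightarrow> step_up below cross k (map p us)"
        unfolding S_def by (simp add: o_def)
      also have "\<dots> \<longleftrightarrow> nat_colour k us"
      proof -
        have "set us \<subseteq> {..<tower k N}"
          using sorted(2)[OF us(1)] N' by auto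
        moreover have "list_all2 (\<lambda>X i. approx \<epsilon> X (p i)) (map p us) us"
          using approx_refl[OF \<epsilon>] by (simp add: list_all2_conv_all_nth)
        ultimately show ?thesis
          using real us(2) sorted(1)[OF us(1)] unfolding realizes_def by blast
      qed
      finally show ?thesis .
    qed
    have "semialgebraic_relation k t k P E"
      unfolding semialgebraic_relation_def using t(2) fs by (auto simp: E_def)
    moreover have "hom_size k P E \<le> 2 ^ k * (N + k)"
    proof -
      have "length Q \<le> 2 ^ k * (N + k)" if Q: "subseq Q P" "homogeneous k E Q" for Q
      proof -
        obtain vs where vs: "subseq vs [0..<N']" "Q = map pt vs"
          using Q(1) subseq_mapD unfolding P_def by blast
        have "map pt us \<in> E \<longleftrightarrow> nat_colour k us" "map pt us \<in> tuples k Q"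
          if "subseq us vs" "length us = k" for us
          using E[of us] that vs by (auto simp: tuples_def subseq_map intro: subseq_order.trans)
        \<comment> \<open>The colour is \<open>True\<close> if all tuples of \<open>Q\<close> lie in
          \<open>E\<close> and \<open>False\<close> if none does.\<close>
        then obtain c where c: "monochrome (nat_colour k) k c vs"
          using Q(2) unfolding homogeneous_def monochrome_def by blast
        have "set vs \<subseteq> {..<tower k N}"
          using sorted(2)[OF vs(1)] N' by auto
        then show ?thesis
          using length_monochrome[OF k sorted(1)[OF vs(1)] _ c] vs(2) by simp
      qed
      moreover have "finite {length Q |Q. subseq Q P \<and> homogeneous k E Q}"
        by (rule finite_subset[of _ "{..length P}"]) (auto dest: list_emb_length)
      \<comment> \<open>The empty sequence has no \<open>k\<close>-tuples; it ensures that the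
        maximum is over a nonempty set.\<close>
      moreover have "homogeneous k E []"
        using k by (auto simp: homogeneous_def tuples_def)
      then have "{length Q |Q. subseq Q P \<and> homogeneous k E Q} \<noteq> {}"
        by (auto intro!: exI[of _ "[]"])
      ultimately show ?thesis
        unfolding hom_size_def by (subst Max_le_iff) auto
    qed
    ultimately show ?thesis
      using P by blast
  qed
  then show ?thesis
    using t(1) by blast
qed

text \<open>A lower bound for \<open>LEAST\<close> requires some candidate to satisfy the condition;
  Ramsey's theorem for \<open>k\<close>-sets provides one.\<close>

lemma hom_size_ramsey: "\<exists>N. \<forall>(P :: 'a list) E. length P = N \<longrightarrow> hom_size k P E \<ge> n"
proof -
  obtain N where N: "partn_lst {..<N::nat} [n, n] k"
    using ramsey2_full by blast
  have "hom_size k P E \<ge> n" if "length P = N" for P :: "'a list" and E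
  proof -
    \<comment> \<open>Ramsey's theorem colours sets, so an index set is read as the tuple of its
      entries of \<open>P\<close> in increasing order of index.\<close>
    define f where "f = (\<lambda>A. if map (nth P) (sorted_list_of_set A) \<in> E then 0 else 1 :: nat)"
    have "f \<in> nsets {..<N} k \<rightarrow> {..<2}"
      by (auto simp: f_def)
    then obtain i H where H: "i < 2" "H \<in> nsets {..<N} ([n, n] ! i)" and f: "f ` nsets H k \<subseteq> {i}"
      by (rule partn_lstE[OF N]) (simp_all add: numeral_2_eq_2)
    have "[n, n] ! i = n"
      using H(1) by (cases i) auto
    then have H: "H \<subseteq> {..<N}" "finite H" "card H = n"
      using H(2) by (auto simp: nsets_def)
    define Q where "Q = map (nth P) (sorted_list_of_set H)"
    have "subseq (sorted_list_of_set H) [0..<N]"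
      using H by (intro sorted_subset_imp_subseq) auto
    then have "subseq Q (map (nth P) [0..<N])"
      unfolding Q_def by (rule subseq_map)
    then have Q: "subseq Q P"
      using that map_nth by metis
    have "(T \<in> E) = (i = 0)" if T: "T \<in> tuples k Q" for T
    proof -
      obtain us where us: "subseq us (sorted_list_of_set H)" "T = map (nth P) us"
        using T subseq_mapD unfolding tuples_def Q_def by blast
      have s: "sorted_wrt (<) us"
        using us(1) by (rule sorted_wrt_subseq) simp
      then have us_eq: "sorted_list_of_set (set us) = us"
        by (simp add: strict_sorted_iff sorted_list_of_set.idem_if_sorted_distinct)
      have "set us \<in> nsets H k"
        using s T us H set_mono_subseq[OF us(1)]
        by (auto simp: nsets_def tuples_def strict_sorted_iff distinct_card)
      then have "f (set us) = i"
        using f by blast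
      then have "(if T \<in> E then 0 else 1) = i"
        by (simp only: f_def us_eq us(2))
      then show ?thesis by (auto split: if_splits)
    qed
    then have "homogeneous k E Q"
      unfolding homogeneous_def by blast
    then have "length Q \<in> {length Q |Q. subseq Q P \<and> homogeneous k E Q}"
      using Q by blast
    moreover have "finite {length Q |Q. subseq Q P \<and> homogeneous k E Q}"
      by (rule finite_subset[of _ "{..length P}"]) (auto dest: list_emb_length)
    ultimately show ?thesis
      unfolding hom_size_def using H by (auto simp: Q_def intro: Max_ge)
  qed
  then show ?thesis by blast
qed

section \<open>Comparison of the towers and choice of constants\<close>

lemma twr_tower: "k \<ge> 2 \<Longrightarrow> twr (k - 1) (real N) = real (tower k N)"
proof (induction k rule: dec_induct)
  case base
  then show ?case by (simp add: numeral_2_eq_2)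
next
  case (step k)
  then obtain m where "k = Suc (Suc m)"
    by (metis add_2_eq_Suc le_Suc_ex)
  then show ?case
    using step by (simp add: tower_Suc powr_realpow)
qed

lemma twr_mono: "x \<le> y \<Longrightarrow> twr i x \<le> twr i y"
  by (induction i x rule: twr.induct) auto

theorem theorem2:
  fixes k :: nat
  assumes "k \<ge> 2"
  shows "\<exists>(d::nat) (t::nat) (c\<^sub>2::real). d \<ge> 1 \<and> t \<ge> 1 \<and> c\<^sub>2 > 0 \<and>
    (\<exists>n\<^sub>0::nat. \<forall>n\<ge>n\<^sub>0. real (semialg_ramsey d t k n) \<ge> twr (k - 1) (c\<^sub>2 * real n))"
proof -
  obtain t where t: "t \<ge> 1" and wit: "\<And>N N'. N' \<le> tower k N \<Longrightarrow> (\<exists>P E. ordered_point_set k P \<and>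
      length P = N' \<and> semialgebraic_relation k t k P E \<and> hom_size k P E \<le> 2 ^ k * (N + k))"
    using semialg_ramsey_witness[OF assms] by blast
  \<comment> \<open>With \<open>N\<close> about \<open>c * n\<close>, the term
    \<open>2 ^ k * N\<close> is about \<open>n / 2\<close>; the other half of \<open>n\<close> pays
    for the additive terms.\<close>
  define c :: real where "c = 1 / 2 ^ Suc k"
  have "real (semialg_ramsey k t k n) \<ge> twr (k - 1) (c * real n)"
    \<comment> \<open>From here on \<open>2 ^ k * (k + 1)\<close>, which includes the loss of
      rounding \<open>c * n\<close> up to \<open>N\<close>, is below \<open>n / 2\<close>.\<close>
    if n: "n \<ge> Suc (2 ^ Suc k * (k + 1))" for n
  proof -
    define N where "N = nat \<lceil>c * real n\<rceil>"
    have cn: "c * real n \<ge> 0"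
      by (simp add: c_def)
    then have N: "c * real n \<le> real N" "real N \<le> c * real n + 1"
      unfolding N_def by linarith+
    have "real (2 ^ k * (N + k)) \<le> 2 ^ k * (c * real n + 1 + real k)"
      using N(2) by simp
    also have "\<dots> = real n / 2 + 2 ^ k * (1 + real k)"
      by (simp add: c_def algebra_simps)
    also have "real n > 2 ^ Suc k * (1 + real k)"
    proof -
      have "real n \<ge> real (Suc (2 ^ Suc k * (k + 1)))"
        using n by (simp only: of_nat_le_iff)
      then show ?thesis by (simp add: algebra_simps)
    qed
    then have "real n / 2 + 2 ^ k * (1 + real k) < real n"
      by simp
    finally have small: "2 ^ k * (N + k) < n"
      by (simp only: of_nat_less_iff)
    define R where "R = semialg_ramsey k t k n"
    have "\<exists>N. \<forall>P E. ordered_point_set k P \<and> length P = N \<and> semialgebraic_relation k t k P E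
        \<longrightarrow> hom_size k P E \<ge> n"
      using hom_size_ramsey[where k = k and n = n and 'a = "real list"] by blast
    then have R: "\<forall>P E. ordered_point_set k P \<and> length P = R \<and> semialgebraic_relation k t k P E
        \<longrightarrow> hom_size k P E \<ge> n"
      unfolding R_def semialg_ramsey_def by (rule LeastI_ex)
    \<comment> \<open>Otherwise the witness on \<open>R\<close> points would have all homogeneous
      sets smaller than \<open>n\<close>, against the property of \<open>R\<close>.\<close>
    have "tower k N < R"
      using R wit[of R N] small by (meson le_less_trans not_le)
    then have "real R \<ge> twr (k - 1) (real N)"
      unfolding twr_tower[OF assms] by simp
    then show ?thesis
      using twr_mono[OF N(1), of "k - 1"] unfolding R_def by linarith
  qed
  moreover have "c > 0"
    by (simp add: c_def)
  ultimately show ?thesis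
    using t assms by (intro exI[of _ k] exI[of _ t] exI[of _ c]) auto
qed

end
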